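(* Let $(T,d)$ be a metric space and $m$ a Borel probability measure on $T$ with $\operatorname{supp}(m)=T$. Let $a,b\ge 0$, $\varphi\in\mathcal{G}_{a,b}$ and $R\ge 2$; put $A=\frac{R^3}{(R-1)(R-2)}$, $B=\frac{R^2}{R-1}$ and $K=(aA+bB)\,\mathcal{S}$. Then there exists a probability measure $\nu$ on $T\times T$ which satisfies $$\left|f(t)-\int_T f(u)\,m(du)\right|\le aA\,\sigma(t)+bB\,\bar{\mathcal{S}}\int_{T\times T}\varphi\left(\frac{|f(u)-f(v)|}{d(u,v)}\right)\nu(du,dv)$$ for every bounded continuous $f:T\to\mathbb{R}$ and every $t\in T$, and for this $\nu$ the following holds. Let $\psi:\mathbb{R}_+\to\mathbb{R}$ be an increasing, continuous function with $\psi(0)=0$, and let $\alpha,\beta\ge 0$ be such that $$\psi(x)\le\alpha+\beta\frac{\varphi(xy)}{\varphi(y)}\qquad\text{for all }x\ge 0,\ y>0.$$ Then for each bounded continuous function $f:T\to\mathbb{R}$, $$\sup_{t\in T}\psi\left(\frac{\left|f(t)-\int_T f(u)\,m(du)\right|}{K}\right)\le\alpha+\beta\int_{T\times T}\varphi\left(\frac{|f(u)-f(v)|}{d(u,v)}\right)\nu(du,dv).$$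
   Context: $B(x,\varepsilon)=\{y\in T:d(x,y)\le\varepsilon\}$ is the closed ball and $D(T)=\sup\{d(s,t):s,t\in T\}$ the diameter of $T$ (possibly $+\infty$). For $a,b\ge0$, $\mathcal{G}_{a,b}$ is the class of all functions $\varphi:\mathbb{R}_+\to\mathbb{R}$ that are (strictly) increasing and continuous, satisfy $\varphi(0)=0$, and satisfy $x\le a+b\frac{\varphi(xy)}{\varphi(y)}$ for all $x\ge 0$, $y\ge\varphi^{-1}(1)$; it is understood that the inverse $\varphi^{-1}$ is defined on $[0,\infty)$. Define $\sigma(x)=\int_0^{D(T)}\varphi^{-1}\left(\frac{1}{m(B(x,\varepsilon))}\right)d\varepsilon\in[0,\infty]$, $\bar{\mathcal{S}}=\int_T\sigma(u)\,m(du)\in[0,\infty]$ and $\mathcal{S}=\sup_{x\in T}\sigma(x)\in[0,\infty]$. Conventions: $0/0=0$ (in particular the integrand equals $\varphi(0)=0$ on the diagonal $u=v$); for $R=2$, $A=+\infty$; $0\cdot\infty=0$; and a finite number divided by $+\infty$ is $0$. *)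

theory Defs
  imports "HOL-Probability.Probability"
begin

definition measure_support :: "'a::topological_space measure \<Rightarrow> 'a set" where
  "measure_support M = {x. \<forall>U. open U \<and> x \<in> U \<longrightarrow> emeasure M U > 0}"

(* Functions R_+ -> R are modelled as real => real; only their values on {0..} are constrained
   or used.  The image condition makes the inverse defined on all of {0..}. *)
definition growth_class :: "real \<Rightarrow> real \<Rightarrow> (real \<Rightarrow> real) set" where
  "growth_class a b =
     {\<phi>. strict_mono_on {0..} \<phi> \<and> continuous_on {0..} \<phi> \<and> \<phi> 0 = 0 \<and> \<phi> ` {0..} = {0..} \<and>
         (\<forall>x\<ge>0. \<forall>y\<ge>inv_into {0..} \<phi> 1. x \<le> a + b * (\<phi> (x * y) / \<phi> y))}"

(* The library's real-valued diameter is of no use for unbounded spaces. *)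
definition ediam :: "'a::metric_space itself \<Rightarrow> ennreal" where
  "ediam _ = (SUP s::'a. SUP t::'a. ennreal (dist s t))"

definition mm_sigma :: "(real \<Rightarrow> real) \<Rightarrow> 'a::metric_space measure \<Rightarrow> 'a \<Rightarrow> ennreal" where
  "mm_sigma \<phi> m x =
     (\<integral>\<^sup>+\<epsilon> \<in> {\<epsilon>. 0 < \<epsilon> \<and> ennreal \<epsilon> < ediam TYPE('a)}.
        ennreal (inv_into {0..} \<phi> (1 / measure m (cball x \<epsilon>))) \<partial>lborel)"

definition mm_mean :: "(real \<Rightarrow> real) \<Rightarrow> 'a::metric_space measure \<Rightarrow> ennreal" where
  "mm_mean \<phi> m = (\<integral>\<^sup>+u. mm_sigma \<phi> m u \<partial>m)"

definition mm_sup :: "(real \<Rightarrow> real) \<Rightarrow> 'a::metric_space measure \<Rightarrow> ennreal" where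
  "mm_sup \<phi> m = (SUP x. mm_sigma \<phi> m x)"

(* On the diagonal the integrand is \<phi> (0 / 0) = \<phi> 0. *)
definition slope_integral ::
    "(real \<Rightarrow> real) \<Rightarrow> ('a::metric_space \<times> 'a) measure \<Rightarrow> ('a \<Rightarrow> real) \<Rightarrow> ennreal" where
  "slope_integral \<phi> \<nu> f = (\<integral>\<^sup>+(u, v). ennreal (\<phi> (\<bar>f u - f v\<bar> / dist u v)) \<partial>\<nu>)"

end

theory Submission
  imports Defs
begin

text \<open>
  Chaining with averages over balls. For the levels \<open>\<phi>\<inverse>(1) R\<^sup>k\<close> let \<open>r\<^sub>k(x)\<close> be the smallest
  radius of a ball around \<open>x\<close> with \<open>1 / m(B) \<le> \<phi>(\<phi>\<inverse>(1) R\<^sup>k)\<close>, and let \<open>S\<^sub>k f(x)\<close> be the mean of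
  \<open>f\<close> over that ball. Then \<open>S\<^sub>0 f\<close> is the global mean, \<open>S\<^sub>n f \<longlonglongrightarrow> f\<close>, and \<open>f - S\<^sub>k f\<close> is controlled by
  the growth condition, which splits each increment into a deterministic part of order \<open>a r\<^sub>k\<close> and
  a part of the form \<open>b \<integral> \<phi>(slope) w\<^sub>k\<close>. The functions \<open>r\<^sub>k\<close> are 1-Lipschitz, so averaging \<open>r\<^sub>k\<close> at later
  levels costs only a geometric series; \<open>\<Sum>\<^sub>k R\<^sup>k r\<^sub>k\<close> is dominated by \<open>\<sigma>\<close>. The measure \<open>\<nu>\<close> is the normalised
  sum of the weights \<open>w\<^sub>k\<close>. The bound involving \<open>\<psi>\<close> follows by applying the first one to
  \<open>f / L\<close>, where \<open>L\<close> is the argument of \<open>\<psi>\<close>: the integral of \<open>\<phi>(slope / L)\<close> is then at least 1.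
\<close>

subsection \<open>Probability measures of full support\<close>

locale full_support_prob = prob_space m for m :: "'a::metric_space measure" +
  assumes sets_m: "sets m = sets borel" and support_m: "measure_support m = UNIV"
begin

lemma space_m [simp]: "space m = UNIV"
  using sets_eq_imp_space_eq[OF sets_m] by simp

lemma emeasure_open_pos: "open U \<Longrightarrow> x \<in> U \<Longrightarrow> 0 < emeasure m U"
  using support_m by (auto simp: measure_support_def)

lemma measure_cball_pos: "0 < e \<Longrightarrow> 0 < measure m (cball x e)"
proof -
  assume "0 < e"
  then have "0 < emeasure m (ball x e)"
    using emeasure_open_pos[of "ball x e" x] by auto
  also have "\<dots> \<le> emeasure m (cball x e)"
    by (intro emeasure_mono) (auto simp: sets_m)
  finally show ?thesis by (simp add: emeasure_eq_measure)
qed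

lemma full_measure_closed:
  assumes "closed C" "measure m C = 1" shows "C = UNIV"
proof (rule ccontr)
  assume "C \<noteq> UNIV"
  then obtain x where "x \<in> - C" by auto
  then have "0 < emeasure m (- C)" using assms(1) by (intro emeasure_open_pos) auto
  moreover have "measure m (- C) = 0"
    using prob_compl[of C] assms by (auto simp: sets_m Compl_eq_Diff_UNIV)
  ultimately show False by (simp add: emeasure_eq_measure)
qed

lemma countable_separated:
  fixes A :: "'a set"
  assumes "0 < e" and sep: "\<And>x y. x \<in> A \<Longrightarrow> y \<in> A \<Longrightarrow> x \<noteq> y \<Longrightarrow> e \<le> dist x y"
  shows "countable A"
proof -
  let ?B = "\<lambda>x. cball x (e / 3)"
  have disj: "disjoint_family_on ?B F" if "F \<subseteq> A" for F
  proof -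
    have False if "x \<in> A" "y \<in> A" "x \<noteq> y" "dist x z \<le> e / 3" "dist y z \<le> e / 3" for x y z
      using sep[OF that(1-3)] dist_triangle2[of x y z] that(4,5) \<open>0 < e\<close> by linarith
    then show ?thesis using \<open>F \<subseteq> A\<close> by (fastforce simp: disjoint_family_on_def)
  qed
  have "(\<lambda>x. measure m (?B x)) summable_on A"
  proof (rule nonneg_bdd_above_summable_on)
    show "bdd_above (sum (\<lambda>x. measure m (?B x)) ` {F. F \<subseteq> A \<and> finite F})"
    proof (rule bdd_aboveI2)
      fix F assume "F \<in> {F. F \<subseteq> A \<and> finite F}"
      then have "sum (\<lambda>x. measure m (?B x)) F = measure m (\<Union>x\<in>F. ?B x)"
        using disj by (intro finite_measure_finite_Union[symmetric]) (auto simp: sets_m)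
      then show "sum (\<lambda>x. measure m (?B x)) F \<le> 1" by simp
    qed
  qed auto
  then have "countable {x\<in>A. measure m (?B x) \<noteq> 0}" by (rule summable_countable_real)
  also have "{x\<in>A. measure m (?B x) \<noteq> 0} = A"
    using measure_cball_pos[of "e / 3"] \<open>0 < e\<close> by (auto simp: less_le)
  finally show ?thesis .
qed

lemma countable_net:
  assumes "0 < e"
  obtains A :: "'a set" where "countable A" "\<And>x. \<exists>y\<in>A. dist x y < e"
proof -
  let ?S = "{A :: 'a set. \<forall>x\<in>A. \<forall>y\<in>A. x \<noteq> y \<longrightarrow> e \<le> dist x y}"
  have "\<exists>M\<in>?S. \<forall>X\<in>?S. M \<subseteq> X \<longrightarrow> X = M"
  proof (rule subset_Zorn_nonempty)
    show "?S \<noteq> {}" by auto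
    fix C assume "C \<noteq> {}" "subset.chain ?S C"
    have "e \<le> dist x y" if xy: "x \<in> \<Union>C" "y \<in> \<Union>C" "x \<noteq> y" for x y
    proof -
      from xy obtain X Y where "X \<in> C" "Y \<in> C" "x \<in> X" "y \<in> Y" by auto
      then obtain Z where "Z \<in> C" "x \<in> Z" "y \<in> Z"
        using \<open>subset.chain ?S C\<close> unfolding subset_chain_def by blast
      then show ?thesis using \<open>subset.chain ?S C\<close> \<open>x \<noteq> y\<close> unfolding subset_chain_def by blast
    qed
    then show "\<Union>C \<in> ?S" by simp
  qed
  then obtain M where M: "M \<in> ?S" "\<And>X. X \<in> ?S \<Longrightarrow> M \<subseteq> X \<Longrightarrow> X = M" by auto
  have "\<exists>y\<in>M. dist x y < e" for x
  proof (rule ccontr)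
    assume "\<not> ?thesis"
    then have far: "\<And>y. y \<in> M \<Longrightarrow> e \<le> dist x y" by force
    have "insert x M \<in> ?S" using M(1) far by (auto simp: dist_commute)
    then have "x \<in> M" using M(2)[of "insert x M"] by auto
    with far[of x] \<open>0 < e\<close> show False by simp
  qed
  moreover have "countable M" by (rule countable_separated[OF \<open>0 < e\<close>]) (use M(1) in auto)
  ultimately show ?thesis using that by blast
qed

lemma open_pair_countable_rectangles:
  fixes W :: "('a \<times> 'a) set"
  assumes "open W"
  obtains \<R> :: "('a set \<times> 'a set) set" where "countable \<R>" "\<And>U V. (U, V) \<in> \<R> \<Longrightarrow> open U \<and> open V"
    "W = (\<Union>(U, V)\<in>\<R>. U \<times> V)"
proof -
  have "\<exists>A :: 'a set. countable A \<and> (\<forall>x. \<exists>y\<in>A. dist x y < inverse (Suc n))" for n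
  proof -
    have "0 < inverse (real (Suc n))" by simp
    then obtain A :: "'a set" where "countable A" "\<And>x. \<exists>y\<in>A. dist x y < inverse (real (Suc n))"
      using countable_net by blast
    then show ?thesis by blast
  qed
  then obtain A :: "nat \<Rightarrow> 'a set" where A: "\<And>n. countable (A n)" "\<And>n x. \<exists>y\<in>A n. dist x y < inverse (Suc n)"
    by metis
  let ?I = "SIGMA n:UNIV. A n \<times> A n"
  let ?g = "\<lambda>(n, p, q). (ball p (inverse (Suc n)), ball q (inverse (Suc n)))"
  let ?R = "{(U, V) \<in> ?g ` ?I. U \<times> V \<subseteq> W}"
  have "countable ?R"
  proof (rule countable_subset[of _ "?g ` ?I"])
    show "countable (?g ` ?I)" by (auto intro!: countable_image countable_SIGMA A)
  qed auto
  moreover have "open U \<and> open V" if "(U, V) \<in> ?R" for U V using that by auto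
  moreover have "W = (\<Union>(U, V)\<in>?R. U \<times> V)"
  proof
    show "W \<subseteq> (\<Union>(U, V)\<in>?R. U \<times> V)"
    proof
      fix w assume "w \<in> W"
      obtain x z where w: "w = (x, z)" by (cases w)
      obtain U V where UV: "open U" "open V" "x \<in> U" "z \<in> V" "U \<times> V \<subseteq> W"
        using assms \<open>w \<in> W\<close> w by (auto elim!: open_prod_elim)
      obtain e1 where e1: "0 < e1" "ball x e1 \<subseteq> U" using UV openE by metis
      obtain e2 where e2: "0 < e2" "ball z e2 \<subseteq> V" using UV openE by metis
      obtain n where n: "inverse (Suc n) < min e1 e2 / 2"
        using reals_Archimedean[of "min e1 e2 / 2"] e1 e2 by auto
      obtain p q where p: "p \<in> A n" "dist x p < inverse (Suc n)"
        and q: "q \<in> A n" "dist z q < inverse (Suc n)" using A(2) by metis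
      have "ball p (inverse (Suc n)) \<subseteq> ball x e1"
      proof
        fix y assume "y \<in> ball p (inverse (Suc n))"
        then show "y \<in> ball x e1" using dist_triangle[of x y p] p(2) n by auto
      qed
      moreover have "ball q (inverse (Suc n)) \<subseteq> ball z e2"
      proof
        fix y assume "y \<in> ball q (inverse (Suc n))"
        then show "y \<in> ball z e2" using dist_triangle[of z y q] q(2) n by auto
      qed
      ultimately have "ball p (inverse (Suc n)) \<times> ball q (inverse (Suc n)) \<subseteq> W"
        using e1 e2 UV by blast
      then have *: "?g (n, p, q) \<in> ?R" using p q by force
      have "w \<in> ball p (inverse (Suc n)) \<times> ball q (inverse (Suc n))"
        using p q w by (auto simp: dist_commute)
      then show "w \<in> (\<Union>(U, V)\<in>?R. U \<times> V)" by (intro UN_I[OF *]) simp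
    qed
  qed auto
  ultimately show ?thesis using that[of ?R] by blast
qed

text \<open>A fully supported probability measure forces separability, whence the type class for
  second countability is not needed to identify the product of the Borel sigma-algebras.\<close>

lemma sets_pair_m: "sets (m \<Otimes>\<^sub>M m) = sets (borel :: ('a \<times> 'a) measure)"
proof
  show "sets (borel :: ('a \<times> 'a) measure) \<subseteq> sets (m \<Otimes>\<^sub>M m)"
    unfolding borel_def
  proof (subst sets_measure_of, simp, rule sets.sigma_sets_subset[of _ "m \<Otimes>\<^sub>M m", simplified space_pair_measure space_m, simplified], clarsimp)
    fix W :: "('a \<times> 'a) set" assume "open W"
    then obtain \<R> where \<R>: "countable \<R>" "\<And>U V. (U, V) \<in> \<R> \<Longrightarrow> open U \<and> open V"
      "W = (\<Union>(U, V)\<in>\<R>. U \<times> V)" using open_pair_countable_rectangles by blast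
    have "(\<Union>(U, V)\<in>\<R>. U \<times> V) \<in> sets (m \<Otimes>\<^sub>M m)"
      using \<R>(1,2) by (intro sets.countable_UN') (auto simp: sets_m intro!: pair_measureI)
    with \<R>(3) show "W \<in> sets (m \<Otimes>\<^sub>M m)" by simp
  qed
  have f: "fst \<in> borel_measurable (borel :: ('a \<times> 'a) measure)"
    and s: "snd \<in> borel_measurable (borel :: ('a \<times> 'a) measure)"
    by (auto intro!: borel_measurable_continuous_onI continuous_intros)
  show "sets (m \<Otimes>\<^sub>M m) \<subseteq> sets (borel :: ('a \<times> 'a) measure)"
  proof (rule sets_pair_in_sets)
    fix A B assume "A \<in> sets m" "B \<in> sets m"
    then have "fst -` A \<inter> snd -` B \<in> sets (borel :: ('a \<times> 'a) measure)"
      using measurable_sets[OF f, of A] measurable_sets[OF s, of B] by (auto simp: sets_m)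
    then show "A \<times> B \<in> sets (borel :: ('a \<times> 'a) measure)"
      by (simp add: vimage_fst vimage_snd Times_Int_Times)
  qed
qed

end

subsection \<open>The growth class\<close>

lemma growth_classD:
  assumes "\<phi> \<in> growth_class a b"
  shows growth_strict_mono: "strict_mono_on {0..} \<phi>"
    and growth_continuous: "continuous_on {0..} \<phi>"
    and growth_0: "\<phi> 0 = 0"
    and growth_image: "\<phi> ` {0..} = {0..}"
    and growth_le: "\<And>x y. 0 \<le> x \<Longrightarrow> inv_into {0..} \<phi> 1 \<le> y \<Longrightarrow> x \<le> a + b * (\<phi> (x * y) / \<phi> y)"
  using assms by (auto simp: growth_class_def)

context
  fixes \<phi> :: "real \<Rightarrow> real" and a b :: real
  assumes \<phi>: "\<phi> \<in> growth_class a b"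
begin

lemma growth_less_iff: "0 \<le> x \<Longrightarrow> 0 \<le> y \<Longrightarrow> \<phi> x < \<phi> y \<longleftrightarrow> x < y"
  using strict_mono_on_less[OF growth_strict_mono[OF \<phi>]] by auto

lemma growth_nonneg: "0 \<le> x \<Longrightarrow> 0 \<le> \<phi> x"
  using growth_image[OF \<phi>] by auto

lemma growth_pos: "0 < x \<Longrightarrow> 0 < \<phi> x"
  using growth_less_iff[of 0 x] growth_0[OF \<phi>] by auto

lemma growth_inv_nonneg: "0 \<le> z \<Longrightarrow> 0 \<le> inv_into {0..} \<phi> z"
  using inv_into_into[of z \<phi> "{0..}"] growth_image[OF \<phi>] by auto

lemma growth_inv: "0 \<le> z \<Longrightarrow> \<phi> (inv_into {0..} \<phi> z) = z"
  using f_inv_into_f[of z \<phi> "{0..}"] growth_image[OF \<phi>] by auto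

lemma growth_inv_less: "0 \<le> x \<Longrightarrow> \<phi> x < z \<Longrightarrow> x < inv_into {0..} \<phi> z"
  using growth_less_iff[of x "inv_into {0..} \<phi> z"] growth_nonneg[of x]
  by (simp add: growth_inv growth_inv_nonneg)

lemma growth_inv_le: "0 \<le> x \<Longrightarrow> \<phi> x \<le> z \<Longrightarrow> x \<le> inv_into {0..} \<phi> z"
  using growth_less_iff[of "inv_into {0..} \<phi> z" x] growth_nonneg[of x] growth_inv_nonneg[of z]
  by (fastforce simp: growth_inv not_less[symmetric])

lemma growth_inv_1_pos: "0 < inv_into {0..} \<phi> 1"
  using growth_inv_less[of 0 1] growth_0[OF \<phi>] by simp

lemma growth_b_pos: "0 \<le> b \<Longrightarrow> 0 < b"
proof (rule ccontr)
  assume "0 \<le> b" "\<not> 0 < b"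
  then have "\<bar>a\<bar> + 1 \<le> a" using growth_le[OF \<phi>, of "\<bar>a\<bar> + 1" "inv_into {0..} \<phi> 1"] by simp
  then show False by simp
qed

lemma growth_comp_measurable:
  assumes "g \<in> borel_measurable M" "\<And>x. x \<in> space M \<Longrightarrow> 0 \<le> g x"
  shows "(\<lambda>x. \<phi> (g x)) \<in> borel_measurable M"
proof -
  have "continuous_on UNIV (\<lambda>x. \<phi> (max 0 x))"
    by (intro continuous_on_compose2[OF growth_continuous[OF \<phi>]] continuous_intros) auto
  then have "(\<lambda>x. \<phi> (max 0 x)) \<in> borel_measurable borel"
    by (rule borel_measurable_continuous_onI)
  from measurable_compose[OF assms(1) this] show ?thesis
    by (rule measurable_cong[THEN iffD1, rotated]) (simp add: assms(2) max_absorb2)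
qed

lemma slope_growth_measurable:
  fixes f :: "'a::metric_space \<Rightarrow> real"
  assumes "continuous_on UNIV f"
  shows "(\<lambda>(u, v). ennreal (\<phi> (\<bar>f u - f v\<bar> / dist u v))) \<in> borel_measurable borel"
proof -
  have f: "continuous_on UNIV (\<lambda>p::'a \<times> 'a. f (fst p))" "continuous_on UNIV (\<lambda>p::'a \<times> 'a. f (snd p))"
    by (auto intro!: continuous_on_compose2[OF assms] continuous_intros)
  have "(\<lambda>p::'a \<times> 'a. \<bar>f (fst p) - f (snd p)\<bar>) \<in> borel_measurable borel"
    "(\<lambda>p::'a \<times> 'a. dist (fst p) (snd p)) \<in> borel_measurable borel"
    by (auto intro!: borel_measurable_continuous_onI continuous_intros f)
  then have "(\<lambda>p::'a \<times> 'a. \<bar>f (fst p) - f (snd p)\<bar> / dist (fst p) (snd p)) \<in> borel_measurable borel"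
    by (rule borel_measurable_divide)
  from growth_comp_measurable[OF this] show ?thesis
    by (simp add: split_beta)
qed

end

subsection \<open>Radii of balls of prescribed measure\<close>

locale majorizing_chain = full_support_prob m for m :: "'a::metric_space measure" +
  fixes \<phi> :: "real \<Rightarrow> real" and a b R D :: real
  assumes \<phi>: "\<phi> \<in> growth_class a b" and a: "0 \<le> a" and b: "0 \<le> b" and R: "2 \<le> R"
    and dist_le: "\<And>x y :: 'a. dist x y \<le> D"
begin

definition level :: "nat \<Rightarrow> real" where "level k = inv_into {0..} \<phi> 1 * R ^ k"

lemma level_pos: "0 < level k" using growth_inv_1_pos[OF \<phi>] R by (simp add: level_def)

lemma level_Suc: "level (Suc k) = R * level k" by (simp add: level_def)

lemma level_ge: "inv_into {0..} \<phi> 1 \<le> level k"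
  using growth_inv_1_pos[OF \<phi>] R one_le_power[of R k] by (simp add: level_def)

lemma D_nonneg: "0 \<le> D" using dist_le[of undefined undefined] by simp

definition rad :: "nat \<Rightarrow> 'a \<Rightarrow> real" where
  "rad k x = Inf {\<epsilon>. 0 \<le> \<epsilon> \<and> 1 \<le> \<phi> (level k) * measure m (cball x \<epsilon>)}"

lemma phi_level_ge_1: "1 \<le> \<phi> (level k)"
proof -
  have "\<phi> (inv_into {0..} \<phi> 1) \<le> \<phi> (level k)"
    using growth_less_iff[OF \<phi>, of "level k" "inv_into {0..} \<phi> 1"] level_ge[of k] level_pos[of k] growth_inv_1_pos[OF \<phi>]
    by (simp add: not_less[symmetric])
  then show ?thesis by (simp add: growth_inv[OF \<phi>])
qed

lemma cball_D: "cball (x :: 'a) D = UNIV" using dist_le by fastforce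

lemma prob_UNIV: "prob UNIV = 1" using prob_space by simp

lemma rad_set: "D \<in> {\<epsilon>. 0 \<le> \<epsilon> \<and> 1 \<le> \<phi> (level k) * measure m (cball x \<epsilon>)}"
  using phi_level_ge_1 D_nonneg by (simp add: cball_D prob_UNIV)

lemma rad_bdd: "bdd_below {\<epsilon>. 0 \<le> \<epsilon> \<and> 1 \<le> \<phi> (level k) * measure m (cball x \<epsilon>)}"
  by (rule bdd_belowI[of _ 0]) auto

lemma rad_nonneg: "0 \<le> rad k x"
  unfolding rad_def using rad_set by (intro cInf_greatest) auto

lemma rad_leI: "0 \<le> e \<Longrightarrow> 1 \<le> \<phi> (level k) * measure m (cball x e) \<Longrightarrow> rad k x \<le> e"
  unfolding rad_def using rad_bdd by (intro cInf_lower) auto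

lemma measure_cball_at_right:
  "(\<lambda>n. measure m (cball x (r + inverse (Suc n)))) \<longlonglongrightarrow> measure m (cball x r)"
proof -
  have "(\<lambda>n. measure m (cball x (r + inverse (Suc n)))) \<longlonglongrightarrow>
    measure m (\<Inter>n. cball x (r + inverse (Suc n)))"
  proof (rule finite_Lim_measure_decseq)
    show "decseq (\<lambda>n. cball x (r + inverse (Suc n)))"
      by (rule antimonoI) (auto intro!: subset_cball simp: field_simps simp del: of_nat_Suc)
  qed (auto simp: sets_m)
  also have "(\<Inter>n. cball x (r + inverse (Suc n))) = cball x r"
  proof (intro equalityI subsetI)
    fix z assume z: "z \<in> (\<Inter>n. cball x (r + inverse (Suc n)))"
    have "(\<lambda>n. r + inverse (real (Suc n))) \<longlonglongrightarrow> r"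
      using tendsto_add[OF tendsto_const LIMSEQ_inverse_real_of_nat, of r] by simp
    then have "dist x z \<le> r" by (rule LIMSEQ_le_const) (use z in auto)
    then show "z \<in> cball x r" by simp
  next
    fix z assume "z \<in> cball x r"
    then show "z \<in> (\<Inter>n. cball x (r + inverse (Suc n)))" 
      by (auto intro: order_trans)
  qed
  finally show ?thesis .
qed

lemma rad_attained: "1 \<le> \<phi> (level k) * measure m (cball x (rad k x))"
proof (rule LIMSEQ_le_const)
  show "(\<lambda>n. \<phi> (level k) * measure m (cball x (rad k x + inverse (Suc n)))) \<longlonglongrightarrow>
    \<phi> (level k) * measure m (cball x (rad k x))"
    by (intro tendsto_intros measure_cball_at_right)
  have "1 \<le> \<phi> (level k) * measure m (cball x (rad k x + inverse (Suc n)))" for n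
  proof -
    have "rad k x < rad k x + inverse (Suc n)" by simp
    then obtain e where e: "0 \<le> e" "1 \<le> \<phi> (level k) * measure m (cball x e)" "e < rad k x + inverse (Suc n)"
      unfolding rad_def using cInf_lessD[OF _ \<open>rad k x < _\<close>[unfolded rad_def]] rad_set by blast
    have "measure m (cball x e) \<le> measure m (cball x (rad k x + inverse (Suc n)))"
      using e(3) by (intro finite_measure_mono) (auto simp: sets_m)
    with e(2) phi_level_ge_1[of k] show ?thesis
      by (meson mult_left_mono order_trans zero_le_one)
  qed
  then show "\<exists>N. \<forall>n\<ge>N. 1 \<le> \<phi> (level k) * measure m (cball x (rad k x + inverse (Suc n)))" by auto
qed

lemma rad_lipschitz: "rad k x \<le> rad k z + dist x z"
proof (rule rad_leI)
  have "cball z (rad k z) \<subseteq> cball x (rad k z + dist x z)"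
    by (auto simp: mem_cball) (smt (verit) dist_triangle)
  then have "measure m (cball z (rad k z)) \<le> measure m (cball x (rad k z + dist x z))"
    by (intro finite_measure_mono) (auto simp: sets_m)
  with rad_attained[of k z] phi_level_ge_1[of k]
  show "1 \<le> \<phi> (level k) * measure m (cball x (rad k z + dist x z))"
    by (meson mult_left_mono order_trans zero_le_one)
qed (simp add: rad_nonneg)

lemma rad_continuous: "continuous_on UNIV (rad k)"

proof (rule lipschitz_on_continuous_on)
  show "1-lipschitz_on UNIV (rad k)"
  proof (rule lipschitz_onI)
    fix x z show "dist (rad k x) (rad k z) \<le> 1 * dist x z"
      using rad_lipschitz[of k x z] rad_lipschitz[of k z x] by (simp add: dist_real_def dist_commute)
  qed simp
qed

lemma level_less_inv:
  assumes "0 < e" "e < rad k x"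
  shows "level k < inv_into {0..} \<phi> (1 / measure m (cball x e))"
proof (rule growth_inv_less[OF \<phi>])
  have "\<phi> (level k) * measure m (cball x e) < 1" using rad_leI[of e k x] assms by force
  then show "\<phi> (level k) < 1 / measure m (cball x e)"
    using measure_cball_pos[OF assms(1), of x] by (simp add: field_simps)
qed (use level_pos less_le in auto)

lemma rad_tendsto_0: "(\<lambda>k. rad k x) \<longlonglongrightarrow> 0"
proof (rule LIMSEQ_I)
  fix e :: real assume "0 < e"
  define v where "v = inv_into {0..} \<phi> (1 / measure m (cball x (e / 2)))"
  obtain N where "v / inv_into {0..} \<phi> 1 < R ^ N" using real_arch_pow[of R] R by auto
  then have "v / inv_into {0..} \<phi> 1 \<le> R ^ k" if "N \<le> k" for k
    using power_increasing[OF that, of R] R that \<open>v / _ < _\<close> by linarith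
  then have N: "N \<le> k \<Longrightarrow> v \<le> level k" for k
    using growth_inv_1_pos[OF \<phi>] by (simp add: level_def field_simps)
  have "rad k x < e" if "N \<le> k" for k
    using level_less_inv[of "e / 2" k x] N[OF that] \<open>0 < e\<close> unfolding v_def by force
  then show "\<exists>N. \<forall>k\<ge>N. norm (rad k x - 0) < e" using rad_nonneg by auto
qed

lemma geometric_le:
  assumes "finite S" "S \<noteq> {}"
  shows "(\<Sum>k\<in>S. level k * (1 - 1 / R)) \<le> level (Max S)"
proof -
  have "(\<Sum>k\<in>S. level k * (1 - 1 / R)) \<le> (\<Sum>k\<le>Max S. level k * (1 - 1 / R))"
    using assms level_pos R by (intro sum_mono2) (auto intro: mult_nonneg_nonneg less_imp_le)
  also have "\<dots> \<le> level n" if "n = Max S" for n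
    unfolding that[symmetric]
  proof (induction n)
    case 0 then show ?case using level_pos[of 0] R by (simp add: field_simps)
  next
    case (Suc n) 
    then show ?case using R by (simp add: level_Suc field_simps)
  qed
  finally show ?thesis by simp
qed

lemma sum_rad_le_sigma:
  "(\<Sum>k. ennreal (level (Suc k) * rad k x)) \<le> ennreal (R\<^sup>2 / (R - 1)) * mm_sigma \<phi> m x"
proof -
  let ?E = "{\<epsilon>. 0 < \<epsilon> \<and> ennreal \<epsilon> < ediam TYPE('a)}"
  let ?h = "\<lambda>\<epsilon>. inv_into {0..} \<phi> (1 / measure m (cball x \<epsilon>))"
  let ?g = "\<lambda>k \<epsilon>. ennreal (level k * (1 - 1 / R)) * indicator {0<..<rad k x} \<epsilon>"
  have pt: "(\<Sum>k. ?g k e) \<le> ennreal (?h e) * indicator ?E e" for e :: real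
  proof (rule suminf_le_const)
    fix n
    let ?S = "{k\<in>{..<n}. 0 < e \<and> e < rad k x}"
    have "(\<Sum>k<n. ?g k e) = (\<Sum>k\<in>?S. ennreal (level k * (1 - 1 / R)))"
      by (auto intro!: sum.mono_neutral_cong_right simp: indicator_def)
    also have "\<dots> = ennreal (\<Sum>k\<in>?S. level k * (1 - 1 / R))"
      using level_pos R by (intro sum_ennreal) (auto intro: mult_nonneg_nonneg less_imp_le)
    also have "\<dots> \<le> ennreal (?h e) * indicator ?E e"
    proof (cases "?S = {}")
      case True
      show ?thesis unfolding True by simp
    next
      case False
      then have "Max ?S \<in> ?S" by (intro Max_in) auto
      then have e: "0 < e" "e < rad (Max ?S) x" by auto
      have "\<not> (\<forall>z. dist x z \<le> e)"
      proof
        assume "\<forall>z::'a. dist x z \<le> e"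
        then have "cball x e = UNIV" by auto
        then have "rad (Max ?S) x \<le> e" using e(1) phi_level_ge_1 by (intro rad_leI) (auto simp: prob_UNIV)
        with e(2) show False by simp
      qed
      then obtain z where "e < dist x z" by (auto simp: not_le)
      then have "ennreal e < ennreal (dist x z)" using e(1) by (simp add: ennreal_less_iff)
      also have "\<dots> \<le> ediam TYPE('a)" unfolding ediam_def by (intro SUP_upper2[of x] SUP_upper) auto
      finally have "e \<in> ?E" using e by simp
      moreover have "(\<Sum>k\<in>?S. level k * (1 - 1 / R)) \<le> ?h e"
        using geometric_le[of ?S] level_less_inv[OF e] False by auto
      ultimately show ?thesis by (simp add: ennreal_leI)
    qed
    finally show "(\<Sum>k<n. ?g k e) \<le> ennreal (?h e) * indicator ?E e" .
  qed simp
  have "(\<Sum>k. ennreal (level k * (1 - 1 / R) * rad k x)) = (\<Sum>k. \<integral>\<^sup>+e. ?g k e \<partial>lborel)"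
    using level_pos R rad_nonneg 
    by (intro suminf_cong) (simp add: nn_integral_cmult_indicator ennreal_mult less_imp_le)
  also have "\<dots> = (\<integral>\<^sup>+e. (\<Sum>k. ?g k e) \<partial>lborel)" by (intro nn_integral_suminf[symmetric]) auto
  also have "\<dots> \<le> mm_sigma \<phi> m x"
    unfolding mm_sigma_def by (intro nn_integral_mono pt)
  finally have *: "(\<Sum>k. ennreal (level k * (1 - 1 / R) * rad k x)) \<le> mm_sigma \<phi> m x" .
  have "(\<Sum>k. ennreal (level (Suc k) * rad k x)) = (\<Sum>k. ennreal (R\<^sup>2 / (R - 1)) * ennreal (level k * (1 - 1 / R) * rad k x))"
  proof (intro suminf_cong)
    fix k
    have "level (Suc k) * rad k x = R\<^sup>2 / (R - 1) * (level k * (1 - 1 / R) * rad k x)"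
      using R by (simp add: level_Suc field_simps power2_eq_square)
    also have "ennreal \<dots> = ennreal (R\<^sup>2 / (R - 1)) * ennreal (level k * (1 - 1 / R) * rad k x)"
      using R level_pos[of k] rad_nonneg[of k x] by (intro ennreal_mult) (auto intro!: mult_nonneg_nonneg)
    finally show "ennreal (level (Suc k) * rad k x) = ennreal (R\<^sup>2 / (R - 1)) * ennreal (level k * (1 - 1 / R) * rad k x)" .
  qed
  also have "\<dots> = ennreal (R\<^sup>2 / (R - 1)) * (\<Sum>k. ennreal (level k * (1 - 1 / R) * rad k x))"
    by (rule ennreal_suminf_cmult)
  also have "\<dots> \<le> ennreal (R\<^sup>2 / (R - 1)) * mm_sigma \<phi> m x" by (intro mult_left_mono *) simp
  finally show ?thesis .
qed

end

subsection \<open>Averaging and chaining\<close>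

context majorizing_chain begin

abbreviation mu :: "nat \<Rightarrow> 'a \<Rightarrow> real" where
  "mu k u \<equiv> measure m (cball u (rad k u))"

definition ker :: "nat \<Rightarrow> 'a \<Rightarrow> 'a \<Rightarrow> real" where
  "ker k u v = indicator (cball u (rad k u)) v / mu k u"

definition avg :: "nat \<Rightarrow> ('a \<Rightarrow> real) \<Rightarrow> 'a \<Rightarrow> real" where
  "avg k f u = (\<integral>v. ker k u v * f v \<partial>m)"

lemma mu_pos: "0 < mu k u"
proof -
  have "mu k u \<noteq> 0" using rad_attained[of k u] by auto
  then show ?thesis using measure_nonneg[of m "cball u (rad k u)"] by linarith
qed

lemma inverse_mu_le: "1 / mu k u \<le> \<phi> (level k)"
  using rad_attained[of k u] mu_pos[of u k] by (simp add: field_simps)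

lemma ker_nonneg: "0 \<le> ker k u v" by (simp add: ker_def)

lemma ker_le: "ker k u v \<le> \<phi> (level k)"
  using inverse_mu_le[of u k] phi_level_ge_1[of k] by (auto simp: ker_def indicator_def)

lemma ker_measurable [measurable]: "(\<lambda>(u, v). ker k u v) \<in> borel_measurable (m \<Otimes>\<^sub>M m)"
proof -
  let ?C = "{p. dist (fst p) (snd p) \<le> rad k (fst p)}"
  have "continuous_on UNIV (\<lambda>p::'a \<times> 'a. rad k (fst p))"
    by (intro continuous_on_compose2[OF rad_continuous] continuous_intros) auto
  then have "closed ?C" by (intro closed_Collect_le continuous_intros)
  then have C: "?C \<in> sets (m \<Otimes>\<^sub>M m)" by (simp add: sets_pair_m)
  have "(\<lambda>u. emeasure m (Pair u -` ?C)) \<in> borel_measurable m"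
    using C by (rule measurable_emeasure_Pair)
  then have "(\<lambda>u. enn2real (emeasure m (Pair u -` ?C))) \<in> borel_measurable m" by measurable
  moreover have "Pair u -` ?C = cball u (rad k u)" for u by auto
  ultimately have "(\<lambda>u. mu k u) \<in> borel_measurable m" by (simp add: measure_def)
  then have "(\<lambda>p. indicator ?C p / mu k (fst p)) \<in> borel_measurable (m \<Otimes>\<^sub>M m)"
    using C by measurable
  moreover have "(\<lambda>p. indicator ?C p / mu k (fst p)) = (\<lambda>(u, v). ker k u v)"
    by (auto simp: fun_eq_iff ker_def indicator_def)
  ultimately show ?thesis by simp
qed

lemma ker_measurable_2 [measurable]: "ker k u \<in> borel_measurable m"
  using measurable_Pair2[OF ker_measurable, of u k] by simp

lemma nn_integral_ker: "(\<integral>\<^sup>+v. ennreal (ker k u v) \<partial>m) = 1"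
proof -
  have "(\<integral>\<^sup>+v. ennreal (ker k u v) \<partial>m) =
    (\<integral>\<^sup>+v. ennreal (1 / mu k u) * indicator (cball u (rad k u)) v \<partial>m)"
    by (intro nn_integral_cong) (auto simp: ker_def indicator_def)
  also have "\<dots> = ennreal (1 / mu k u) * ennreal (mu k u)"
    by (subst nn_integral_cmult_indicator) (auto simp: sets_m emeasure_eq_measure)
  also have "\<dots> = 1"
    using mu_pos[of u k] by (simp add: ennreal_mult[symmetric] less_imp_le)
  finally show ?thesis .
qed

lemma integrable_ker: "integrable m (ker k u)"
  using nn_integral_ker by (intro integrableI_nonneg) (auto simp: ker_nonneg)

lemma integral_ker: "(\<integral>v. ker k u v \<partial>m) = 1"
  using nn_integral_ker by (subst integral_eq_nn_integral) (auto simp: ker_nonneg)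

definition slope :: "('a \<Rightarrow> real) \<Rightarrow> 'a \<Rightarrow> 'a \<Rightarrow> real" where
  "slope f u v = \<bar>f u - f v\<bar> / dist u v"

definition weight :: "nat \<Rightarrow> 'a \<Rightarrow> 'a \<Rightarrow> real" where
  "weight k u v = level (Suc k) * rad k u * ker k u v"

definition energy :: "nat \<Rightarrow> ('a \<Rightarrow> real) \<Rightarrow> 'a \<Rightarrow> ennreal" where
  "energy k f u = (\<integral>\<^sup>+v. ennreal (weight k u v) * ennreal (\<phi> (slope f u v)) \<partial>m)"

lemma weight_nonneg: "0 \<le> weight k u v"
  using level_pos[of "Suc k"] by (simp add: weight_def rad_nonneg ker_nonneg)

lemma rad_measurable [measurable]: "rad k \<in> borel_measurable m"
  using borel_measurable_continuous_onI[OF rad_continuous] by (simp add: measurable_cong_sets[OF sets_m refl])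

lemma weight_measurable [measurable]: "(\<lambda>(u, v). weight k u v) \<in> borel_measurable (m \<Otimes>\<^sub>M m)"
  unfolding weight_def by measurable

end

locale majorizing_chain_fun = majorizing_chain m \<phi> a b R D
  for m :: "'a::metric_space measure" and \<phi> a b R D +
  fixes f :: "'a \<Rightarrow> real"
  assumes bounded_f: "bounded (range f)" and continuous_f: "continuous_on UNIV f"
begin

lemma f_measurable [measurable]: "f \<in> borel_measurable m"
  using borel_measurable_continuous_onI[OF continuous_f] by (simp add: measurable_cong_sets[OF sets_m refl])

lemma slope_measurable [measurable]:
  "(\<lambda>(u, v). ennreal (\<phi> (slope f u v))) \<in> borel_measurable (m \<Otimes>\<^sub>M m)"
  using slope_growth_measurable[OF \<phi> continuous_f]
  by (simp add: slope_def measurable_cong_sets[OF sets_pair_m refl])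

lemma slope_measurable_2 [measurable]: "(\<lambda>v. ennreal (\<phi> (slope f u v))) \<in> borel_measurable m"
  using measurable_Pair2[OF slope_measurable, of u] by simp

lemma weight_measurable_2 [measurable]: "weight k u \<in> borel_measurable m"
  using measurable_Pair2[OF weight_measurable, of u k] by simp

lemma energy_measurable [measurable]: "energy k f \<in> borel_measurable m"
  unfolding energy_def by measurable

lemma phi_slope_nonneg: "0 \<le> \<phi> (slope f u v)"
  by (intro growth_nonneg[OF \<phi>]) (simp add: slope_def)

lemma f_bound: obtains C where "\<And>x. \<bar>f x\<bar> \<le> C"
  using bounded_f by (auto simp: bounded_iff)

lemma integrable_ker_f: "integrable m (\<lambda>v. ker k u v * f v)"
proof -
  obtain C where C: "\<And>x. \<bar>f x\<bar> \<le> C" using f_bound by blast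
  show ?thesis
  proof (rule Bochner_Integration.integrable_bound[OF integrable_mult_right[OF integrable_ker[of k u], of C]])
    show "AE v in m. norm (ker k u v * f v) \<le> norm (C * ker k u v)"
      using C ker_nonneg[of k u] order_trans[OF abs_ge_zero C]
      by (auto simp: abs_mult mult.commute intro!: mult_right_mono)
  qed measurable
qed

lemma avg_deviation:
  "ennreal \<bar>c - avg k f u\<bar> \<le> (\<integral>\<^sup>+v. ennreal (ker k u v) * ennreal \<bar>c - f v\<bar> \<partial>m)"
proof -
  have "c - avg k f u = (\<integral>v. ker k u v * c - ker k u v * f v \<partial>m)"
    using integrable_ker integrable_ker_f integral_ker by (simp add: avg_def)
  also have "ennreal \<bar>\<dots>\<bar> \<le> (\<integral>\<^sup>+v. ennreal \<bar>ker k u v * c - ker k u v * f v\<bar> \<partial>m)"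
    using integral_norm_bound_ennreal[of m "\<lambda>v. ker k u v * c - ker k u v * f v"]
      integrable_ker integrable_ker_f by simp
  also have "\<dots> = (\<integral>\<^sup>+v. ennreal (ker k u v) * ennreal \<bar>c - f v\<bar> \<partial>m)"
    by (intro nn_integral_cong)
      (simp add: right_diff_distrib[symmetric] abs_mult ker_nonneg ennreal_mult)
  finally show ?thesis .
qed

lemma local_growth:
  assumes "dist u v \<le> rad k u"
  shows "\<bar>f u - f v\<bar> \<le> level (Suc k) * rad k u * (a + b * (\<phi> (slope f u v) / \<phi> (level (Suc k))))"
proof -
  let ?s = "slope f u v"
  have s: "0 \<le> ?s" by (simp add: slope_def)
  have "?s / level (Suc k) \<le> a + b * (\<phi> (?s / level (Suc k) * level (Suc k)) / \<phi> (level (Suc k)))"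
    using s level_pos[of "Suc k"] level_ge by (intro growth_le[OF \<phi>]) auto
  then have "?s \<le> level (Suc k) * (a + b * (\<phi> ?s / \<phi> (level (Suc k))))"
    using level_pos[of "Suc k"] by (simp add: divide_le_eq mult.commute)
  moreover have "\<bar>f u - f v\<bar> = dist u v * ?s" by (cases "u = v") (auto simp: slope_def)
  ultimately have "\<bar>f u - f v\<bar> \<le> rad k u * (level (Suc k) * (a + b * (\<phi> ?s / \<phi> (level (Suc k)))))"
    using assms s rad_nonneg by (auto intro!: mult_mono)
  then show ?thesis by (simp add: ac_simps)
qed

lemma local_oscillation:
  "ennreal \<bar>f u - avg k f u\<bar>
    \<le> ennreal (a * level (Suc k) * rad k u) + ennreal (b / \<phi> (level (Suc k))) * energy k f u"
proof -
  let ?Y = "level (Suc k)" let ?A = "a * ?Y * rad k u"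
  have A: "0 \<le> ?A" using a level_pos[of "Suc k"] rad_nonneg by (auto intro!: mult_nonneg_nonneg less_imp_le)
  have pos: "0 < \<phi> ?Y" by (intro growth_pos[OF \<phi>] level_pos)
  have "ennreal \<bar>f u - avg k f u\<bar> \<le> (\<integral>\<^sup>+v. ennreal (ker k u v) * ennreal \<bar>f u - f v\<bar> \<partial>m)"
    by (rule avg_deviation)
  also have "\<dots> \<le> (\<integral>\<^sup>+v. ennreal ?A * ennreal (ker k u v) +
      ennreal (b / \<phi> ?Y) * (ennreal (weight k u v) * ennreal (\<phi> (slope f u v))) \<partial>m)"
  proof (rule nn_integral_mono)
    fix v
    have "ker k u v * \<bar>f u - f v\<bar> \<le> ker k u v * (?Y * rad k u * (a + b * (\<phi> (slope f u v) / \<phi> ?Y)))"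
    proof (cases "dist u v \<le> rad k u")
      case True
      then show ?thesis by (intro mult_left_mono local_growth ker_nonneg)
    next
      case False
      then show ?thesis by (simp add: ker_def)
    qed
    also have "\<dots> = ?A * ker k u v + b / \<phi> ?Y * (weight k u v * \<phi> (slope f u v))"
      by (simp add: weight_def algebra_simps)
    finally have "ennreal (ker k u v * \<bar>f u - f v\<bar>) \<le>
        ennreal (?A * ker k u v + b / \<phi> ?Y * (weight k u v * \<phi> (slope f u v)))"
      by (rule ennreal_leI)
    then show "ennreal (ker k u v) * ennreal \<bar>f u - f v\<bar> \<le> ennreal ?A * ennreal (ker k u v) +
      ennreal (b / \<phi> ?Y) * (ennreal (weight k u v) * ennreal (\<phi> (slope f u v)))"
      using A pos b ker_nonneg[of k u v] weight_nonneg[of k u v] phi_slope_nonneg[of u v]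
      by (simp only: ennreal_mult[symmetric] ennreal_plus[symmetric] mult_nonneg_nonneg divide_nonneg_pos abs_ge_zero)
  qed
  also have "\<dots> = ennreal ?A + ennreal (b / \<phi> ?Y) * energy k f u"
    by (subst nn_integral_add) (simp_all add: nn_integral_cmult nn_integral_ker energy_def)
  finally show ?thesis .
qed

end

context majorizing_chain_fun begin

text \<open>For \<open>R = 2\<close> the division by zero makes \<open>bound\<close> vanish; this is only used when \<open>a = 0\<close>.\<close>

definition bound :: "nat \<Rightarrow> 'a \<Rightarrow> real" where
  "bound n x = a / (R - 2) * ((R - 1) * (\<Sum>k<n. level (Suc k) * rad k x) + level (Suc n) * rad n x)"

lemma sum_level_le: "(R - 1) * (\<Sum>k<n. level (Suc k)) \<le> level (Suc n)"
proof (induction n)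
  case 0 then show ?case using level_pos[of "Suc 0"] by simp
next
  case (Suc n)
  then show ?case by (simp add: level_Suc[of "Suc n"] algebra_simps)
qed

lemma bound_nonneg: "0 \<le> bound n x"
  unfolding bound_def using a R level_pos rad_nonneg
  by (intro mult_nonneg_nonneg add_nonneg_nonneg sum_nonneg) (auto intro: less_imp_le)

lemma bound_step:
  assumes 2: "R = 2 \<Longrightarrow> a = 0" and d: "dist x u \<le> rad (Suc n) x"
  shows "a * level (Suc n) * rad n u + bound n u \<le> bound (Suc n) x"
proof -
  define E where "E = a / (R - 2)"
  define Y where "Y = level (Suc n)"
  define s where "s = (\<Sum>k<n. level (Suc k) * rad k x)"
  have E: "0 \<le> E" using a R by (simp add: E_def)
  have aE: "a = E * (R - 2)" using 2 by (auto simp: E_def)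
  have Y: "0 < Y" using level_pos by (simp add: Y_def)
  have "(R - 1) * (\<Sum>k<n. level (Suc k) * rad k u) \<le> (R - 1) * (\<Sum>k<n. level (Suc k) * (rad k x + dist x u))"
    using R level_pos rad_lipschitz[of _ u x]
    by (intro mult_left_mono sum_mono) (auto simp: dist_commute intro: less_imp_le)
  also have "\<dots> = (R - 1) * s + ((R - 1) * (\<Sum>k<n. level (Suc k))) * dist x u"
    by (simp add: s_def algebra_simps sum.distrib sum_distrib_left)
  also have "\<dots> \<le> (R - 1) * s + Y * dist x u"
    using sum_level_le[of n] by (intro add_left_mono mult_right_mono) (auto simp: Y_def)
  finally have 1: "(R - 1) * (\<Sum>k<n. level (Suc k) * rad k u) \<le> (R - 1) * s + Y * dist x u" .
  have 3: "(R - 1) * Y * rad n u \<le> (R - 1) * Y * (rad n x + dist x u)"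
    using rad_lipschitz[of n u x] R Y by (intro mult_left_mono) (auto simp: dist_commute)
  have 4: "R * Y * dist x u \<le> R * Y * rad (Suc n) x"
    using d R Y by (intro mult_left_mono) auto
  have "(R - 1) * (\<Sum>k<n. level (Suc k) * rad k u) + (R - 1) * Y * rad n u
      \<le> (R - 1) * (s + Y * rad n x) + R * Y * rad (Suc n) x"
    using 1 3 4 by (simp add: algebra_simps)
  then have "E * ((R - 1) * (\<Sum>k<n. level (Suc k) * rad k u) + (R - 1) * Y * rad n u)
      \<le> E * ((R - 1) * (s + Y * rad n x) + R * Y * rad (Suc n) x)"
    using E by (rule mult_left_mono)
  moreover have "a * Y * rad n u + bound n u =
      E * ((R - 1) * (\<Sum>k<n. level (Suc k) * rad k u) + (R - 1) * Y * rad n u)"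
    unfolding bound_def E_def[symmetric] Y_def[symmetric] by (subst aE) (simp add: algebra_simps)
  moreover have "bound (Suc n) x = E * ((R - 1) * (s + Y * rad n x) + R * Y * rad (Suc n) x)"
    unfolding bound_def E_def[symmetric] by (simp add: level_Suc[of "Suc n"] Y_def s_def)
  ultimately show ?thesis by (simp add: Y_def)
qed

lemma avg_0: "avg 0 f x = (\<integral>u. f u \<partial>m)"
proof -
  have "1 \<le> measure m (cball x (rad 0 x))"
    using rad_attained[of 0 x] by (simp add: level_def growth_inv[OF \<phi>])
  then have 1: "measure m (cball x (rad 0 x)) = 1" using prob_le_1 by (intro antisym)
  then have "cball x (rad 0 x) = UNIV" by (intro full_measure_closed) auto
  with 1 show ?thesis by (simp add: avg_def ker_def)
qed

lemma chaining_step: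
  assumes 2: "R = 2 \<Longrightarrow> a = 0"
    and IH: "\<And>u. ennreal \<bar>avg n f u - c\<bar> \<le> ennreal (bound n u) + q"
  shows "ennreal \<bar>avg (Suc n) f x - c\<bar>
    \<le> ennreal (bound (Suc n) x) + (q + ennreal b * (\<integral>\<^sup>+u. energy n f u \<partial>m))"
proof -
  let ?p = "\<phi> (level (Suc n))"
  have pos: "0 < ?p" by (intro growth_pos[OF \<phi>] level_pos)
  have "ennreal \<bar>avg (Suc n) f x - c\<bar> \<le> (\<integral>\<^sup>+u. ennreal (ker (Suc n) x u) * ennreal \<bar>c - f u\<bar> \<partial>m)"
    using avg_deviation[of c "Suc n" x] by (simp add: abs_minus_commute)
  also have "\<dots> \<le> (\<integral>\<^sup>+u. (ennreal (bound (Suc n) x) + q) * ennreal (ker (Suc n) x u)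
      + ennreal b * energy n f u \<partial>m)"
  proof (rule nn_integral_mono)
    fix u
    show "ennreal (ker (Suc n) x u) * ennreal \<bar>c - f u\<bar>
      \<le> (ennreal (bound (Suc n) x) + q) * ennreal (ker (Suc n) x u) + ennreal b * energy n f u"
    proof (cases "dist x u \<le> rad (Suc n) x")
      case True
      have A: "0 \<le> a * level (Suc n) * rad n u"
        using a level_pos[of "Suc n"] rad_nonneg by (auto intro!: mult_nonneg_nonneg less_imp_le)
      have "ennreal \<bar>c - f u\<bar> \<le> ennreal (\<bar>f u - avg n f u\<bar> + \<bar>avg n f u - c\<bar>)"
        by (intro ennreal_leI) linarith
      also have "\<dots> = ennreal \<bar>f u - avg n f u\<bar> + ennreal \<bar>avg n f u - c\<bar>" by simp
      also have "\<dots> \<le> (ennreal (a * level (Suc n) * rad n u) + ennreal (b / ?p) * energy n f u)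
          + (ennreal (bound n u) + q)"
        by (intro add_mono local_oscillation IH)
      also have "\<dots> = ennreal (a * level (Suc n) * rad n u + bound n u) + q + ennreal (b / ?p) * energy n f u"
        using A bound_nonneg by (simp add: ac_simps)
      also have "\<dots> \<le> ennreal (bound (Suc n) x) + q + ennreal (b / ?p) * energy n f u"
        by (intro add_right_mono ennreal_leI bound_step 2 True)
      finally have "ennreal (ker (Suc n) x u) * ennreal \<bar>c - f u\<bar> \<le>
        ennreal (ker (Suc n) x u) * (ennreal (bound (Suc n) x) + q + ennreal (b / ?p) * energy n f u)"
        by (rule mult_left_mono) simp
      also have "\<dots> = (ennreal (bound (Suc n) x) + q) * ennreal (ker (Suc n) x u)
          + ennreal (ker (Suc n) x u * (b / ?p)) * energy n f u"
        using ker_nonneg[of "Suc n" x u] pos b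
        by (subst ennreal_mult) (auto simp: distrib_left ac_simps)
      also have "\<dots> \<le> (ennreal (bound (Suc n) x) + q) * ennreal (ker (Suc n) x u) + ennreal b * energy n f u"
      proof (intro add_left_mono mult_right_mono ennreal_leI)
        show "ker (Suc n) x u * (b / ?p) \<le> b"
          using mult_right_mono[OF ker_le[of "Suc n" x u] b] pos by (simp add: field_simps)
      qed simp
      finally show ?thesis .
    qed (simp add: ker_def)
  qed
  also have "\<dots> = ennreal (bound (Suc n) x) + q + ennreal b * (\<integral>\<^sup>+u. energy n f u \<partial>m)"
    by (subst nn_integral_add) (simp_all add: nn_integral_cmult nn_integral_ker)
  finally show ?thesis by (simp add: ac_simps)
qed

lemma chaining_bound:
  assumes "R = 2 \<Longrightarrow> a = 0"
  shows "ennreal \<bar>avg n f x - (\<integral>u. f u \<partial>m)\<bar>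
    \<le> ennreal (bound n x) + ennreal b * (\<Sum>k<n. \<integral>\<^sup>+u. energy k f u \<partial>m)"
proof (induction n arbitrary: x)
  case 0 then show ?case by (simp add: avg_0)
next
  case (Suc n)
  from chaining_step[OF assms Suc.IH, of x] show ?case by (simp add: distrib_left ac_simps)
qed

lemma avg_tendsto: "(\<lambda>n. avg n f t) \<longlonglongrightarrow> f t"
proof (rule LIMSEQ_I)
  fix r :: real assume r: "0 < r"
  have "isCont f t" using continuous_f by (simp add: continuous_on_eq_continuous_at)
  then obtain d where d: "0 < d" "\<And>v. dist v t < d \<Longrightarrow> dist (f v) (f t) < r / 2"
    unfolding continuous_at_eps_delta using r by (metis half_gt_zero)
  obtain N where N: "\<And>n. N \<le> n \<Longrightarrow> rad n t < d"
    using LIMSEQ_D[OF rad_tendsto_0 d(1), of t] rad_nonneg by auto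
  have "norm (avg n f t - f t) < r" if "N \<le> n" for n
  proof -
    have "ennreal \<bar>f t - avg n f t\<bar> \<le> (\<integral>\<^sup>+v. ennreal (ker n t v) * ennreal \<bar>f t - f v\<bar> \<partial>m)"
      by (rule avg_deviation)
    also have "\<dots> \<le> (\<integral>\<^sup>+v. ennreal (ker n t v) * ennreal (r / 2) \<partial>m)"
    proof (rule nn_integral_mono)
      fix v
      show "ennreal (ker n t v) * ennreal \<bar>f t - f v\<bar> \<le> ennreal (ker n t v) * ennreal (r / 2)"
      proof (cases "dist t v \<le> rad n t")
        case True
        then have "dist (f v) (f t) < r / 2" using d(2)[of v] N[OF that] by (simp add: dist_commute)
        then show ?thesis by (intro mult_left_mono ennreal_leI) (auto simp: dist_real_def abs_minus_commute)
      qed (simp add: ker_def)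
    qed
    also have "\<dots> = ennreal (r / 2)" by (simp add: nn_integral_multc nn_integral_ker)
    finally show ?thesis using r by (simp add: abs_minus_commute)
  qed
  then show "\<exists>N. \<forall>n\<ge>N. norm (avg n f t - f t) < r" by blast
qed

lemma bound_le_sigma:
  "ennreal (bound n x) \<le> ennreal (a / (R - 2) * R\<^sup>2) * mm_sigma \<phi> m x"
proof -
  have E: "0 \<le> a / (R - 2)" using a R by simp
  have pos: "0 \<le> level (Suc k) * rad k x" for k using level_pos[of "Suc k"] rad_nonneg by simp
  have "level (Suc n) * rad n x \<le> (R - 1) * (level (Suc n) * rad n x)"
    using R mult_right_mono[OF _ pos[of n], of 1 "R - 1"] by simp
  then have "bound n x \<le> a / (R - 2) * ((R - 1) * (\<Sum>k<Suc n. level (Suc k) * rad k x))"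
    unfolding bound_def using E by (intro mult_left_mono) (auto simp: distrib_left)
  then have "ennreal (bound n x) \<le> ennreal (a / (R - 2) * (R - 1) * (\<Sum>k<Suc n. level (Suc k) * rad k x))"
    by (intro ennreal_leI) (simp only: mult.assoc)
  also have "\<dots> = ennreal (a / (R - 2) * (R - 1)) * (\<Sum>k<Suc n. ennreal (level (Suc k) * rad k x))"
    using E R by (subst sum_ennreal[OF pos], intro ennreal_mult sum_nonneg pos mult_nonneg_nonneg) auto
  also have "\<dots> \<le> ennreal (a / (R - 2) * (R - 1)) * (\<Sum>k. ennreal (level (Suc k) * rad k x))"
    by (intro mult_left_mono sum_le_suminf) auto
  also have "\<dots> \<le> ennreal (a / (R - 2) * (R - 1)) * (ennreal (R\<^sup>2 / (R - 1)) * mm_sigma \<phi> m x)"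
    by (intro mult_left_mono sum_rad_le_sigma) simp
  also have "\<dots> = ennreal (a / (R - 2) * R\<^sup>2) * mm_sigma \<phi> m x"
  proof -
    have "ennreal (a / (R - 2) * (R - 1)) * ennreal (R\<^sup>2 / (R - 1)) = ennreal (a / (R - 2) * R\<^sup>2)"
      using a R by (subst ennreal_mult[symmetric]) auto
    then show ?thesis by (simp only: mult.assoc[symmetric])
  qed
  finally show ?thesis .
qed

lemma deviation_le_energy:
  assumes "R = 2 \<Longrightarrow> a = 0"
  shows "ennreal \<bar>f t - (\<integral>u. f u \<partial>m)\<bar>
    \<le> ennreal (a / (R - 2) * R\<^sup>2) * mm_sigma \<phi> m t + ennreal b * (\<Sum>k. \<integral>\<^sup>+u. energy k f u \<partial>m)"
proof (rule LIMSEQ_le_const2)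
  show "(\<lambda>n. ennreal \<bar>avg n f t - (\<integral>u. f u \<partial>m)\<bar>) \<longlonglongrightarrow> ennreal \<bar>f t - (\<integral>u. f u \<partial>m)\<bar>"
    by (intro tendsto_ennrealI tendsto_intros avg_tendsto)
  have "ennreal \<bar>avg n f t - (\<integral>u. f u \<partial>m)\<bar> \<le> ennreal (a / (R - 2) * R\<^sup>2) * mm_sigma \<phi> m t
      + ennreal b * (\<Sum>k. \<integral>\<^sup>+u. energy k f u \<partial>m)" for n
    using assms by (intro order_trans[OF chaining_bound] add_mono bound_le_sigma mult_left_mono sum_le_suminf) auto
  then show "\<exists>N. \<forall>n\<ge>N. ennreal \<bar>avg n f t - (\<integral>u. f u \<partial>m)\<bar> \<le> ennreal (a / (R - 2) * R\<^sup>2) * mm_sigma \<phi> m t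
      + ennreal b * (\<Sum>k. \<integral>\<^sup>+u. energy k f u \<partial>m)" by blast
qed

end

subsection \<open>The measure on the product\<close>

context majorizing_chain begin

definition dens :: "'a \<times> 'a \<Rightarrow> ennreal" where
  "dens = (\<lambda>(u, v). \<Sum>k. ennreal (weight k u v))"

lemma dens_measurable [measurable]: "dens \<in> borel_measurable (m \<Otimes>\<^sub>M m)"
  unfolding dens_def by measurable

lemma dens_mass_le:
  "(\<integral>\<^sup>+p. dens p \<partial>(m \<Otimes>\<^sub>M m)) \<le> ennreal (R\<^sup>2 / (R - 1)) * mm_mean \<phi> m"
proof -
  let ?B = "R\<^sup>2 / (R - 1)"
  let ?T = "\<lambda>u. \<Sum>k. ennreal (level (Suc k) * rad k u)"
  have B: "0 < ?B" using R by simp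
  have inv: "ennreal ?B * ennreal (1 / ?B) = 1" "ennreal (1 / ?B) * ennreal ?B = 1"
    using R by (auto simp: ennreal_mult[symmetric])
  have "(\<integral>\<^sup>+p. dens p \<partial>(m \<Otimes>\<^sub>M m)) = (\<integral>\<^sup>+u. \<integral>\<^sup>+v. dens (u, v) \<partial>m \<partial>m)"
    by (rule nn_integral_fst[symmetric]) measurable
  also have "\<dots> = (\<integral>\<^sup>+u. ?T u \<partial>m)"
  proof (rule nn_integral_cong)
    fix u
    have "(\<integral>\<^sup>+v. dens (u, v) \<partial>m) = (\<Sum>k. \<integral>\<^sup>+v. ennreal (weight k u v) \<partial>m)"
      unfolding dens_def prod.case by (intro nn_integral_suminf) measurable
    also have "\<dots> = ?T u"
    proof (intro suminf_cong)
      fix k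
      have "(\<integral>\<^sup>+v. ennreal (weight k u v) \<partial>m) = (\<integral>\<^sup>+v. ennreal (level (Suc k) * rad k u) * ennreal (ker k u v) \<partial>m)"
        using level_pos[of "Suc k"] rad_nonneg by (intro nn_integral_cong) (simp add: weight_def ennreal_mult ker_nonneg)
      then show "(\<integral>\<^sup>+v. ennreal (weight k u v) \<partial>m) = ennreal (level (Suc k) * rad k u)"
        by (simp add: nn_integral_cmult nn_integral_ker)
    qed
    finally show "(\<integral>\<^sup>+v. dens (u, v) \<partial>m) = ?T u" .
  qed
  also have "\<dots> = (\<integral>\<^sup>+u. ennreal ?B * (ennreal (1 / ?B) * ?T u) \<partial>m)"
    by (simp only: mult.assoc[symmetric] inv mult_1)
  also have "\<dots> = ennreal ?B * (\<integral>\<^sup>+u. ennreal (1 / ?B) * ?T u \<partial>m)"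
    by (rule nn_integral_cmult) measurable
  also have "\<dots> \<le> ennreal ?B * mm_mean \<phi> m"
    unfolding mm_mean_def
  proof (intro mult_left_mono nn_integral_mono)
    fix u
    have "ennreal (1 / ?B) * ?T u \<le> ennreal (1 / ?B) * (ennreal ?B * mm_sigma \<phi> m u)"
      by (intro mult_left_mono sum_rad_le_sigma) simp
    also have "\<dots> = mm_sigma \<phi> m u"
      by (simp only: mult.assoc[symmetric] inv mult_1)
    finally show "ennreal (1 / ?B) * ?T u \<le> mm_sigma \<phi> m u" .
  qed simp
  finally show ?thesis .
qed

lemma sum_energy_eq:
  assumes "bounded (range f)" "continuous_on UNIV f"
  shows "(\<Sum>k. \<integral>\<^sup>+u. energy k f u \<partial>m) =
    (\<integral>\<^sup>+p. dens p * ennreal (\<phi> (\<bar>f (fst p) - f (snd p)\<bar> / dist (fst p) (snd p))) \<partial>(m \<Otimes>\<^sub>M m))"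
proof -
  interpret majorizing_chain_fun m \<phi> a b R D f by unfold_locales (use assms in auto)
  let ?g = "\<lambda>p. ennreal (\<phi> (slope f (fst p) (snd p)))"
  have [measurable]: "?g \<in> borel_measurable (m \<Otimes>\<^sub>M m)"
    using slope_measurable by (simp add: split_beta)
  have [measurable]: "(\<lambda>p. ennreal (weight k (fst p) (snd p))) \<in> borel_measurable (m \<Otimes>\<^sub>M m)" for k
    using weight_measurable[of k] by (simp add: split_beta)
  have "(\<Sum>k. \<integral>\<^sup>+u. energy k f u \<partial>m) = (\<Sum>k. \<integral>\<^sup>+p. ennreal (weight k (fst p) (snd p)) * ?g p \<partial>(m \<Otimes>\<^sub>M m))"
    unfolding energy_def by (intro suminf_cong) (subst nn_integral_fst[symmetric]; simp)
  also have "\<dots> = (\<integral>\<^sup>+p. (\<Sum>k. ennreal (weight k (fst p) (snd p)) * ?g p) \<partial>(m \<Otimes>\<^sub>M m))"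
    by (intro nn_integral_suminf[symmetric]) measurable
  also have "\<dots> = (\<integral>\<^sup>+p. dens p * ?g p \<partial>(m \<Otimes>\<^sub>M m))"
    by (simp add: dens_def split_beta ennreal_suminf_multc)
  finally show ?thesis by (simp add: slope_def)
qed

lemma exists_energy_measure:
  assumes fin: "mm_mean \<phi> m < \<infinity>"
  obtains \<nu> :: "('a \<times> 'a) measure" where "prob_space \<nu>" "sets \<nu> = sets borel"
    "\<And>f. bounded (range f) \<Longrightarrow> continuous_on UNIV f \<Longrightarrow>
      (\<Sum>k. \<integral>\<^sup>+u. energy k f u \<partial>m) \<le> ennreal (R\<^sup>2 / (R - 1)) * mm_mean \<phi> m * slope_integral \<phi> \<nu> f"
proof -
  let ?mm = "m \<Otimes>\<^sub>M m"
  define M where "M = (\<integral>\<^sup>+p. dens p \<partial>?mm)"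
  interpret mm: pair_prob_space m m by unfold_locales
  have Mfin: "M < \<infinity>"
    unfolding M_def using fin by (intro le_less_trans[OF dens_mass_le]) (simp add: ennreal_mult_less_top)
  show ?thesis
  proof (cases "M = 0")
    case True
    have "AE p in ?mm. dens p = 0" using True by (simp add: M_def nn_integral_0_iff_AE)
    then have "(\<Sum>k. \<integral>\<^sup>+u. energy k f u \<partial>m) = 0" if "bounded (range f)" "continuous_on UNIV f" for f
      unfolding sum_energy_eq[OF that]
      by (subst nn_integral_cong_AE[where v = "\<lambda>_. 0"]) auto
    then show ?thesis using that[of ?mm] sets_pair_m mm.prob_space_axioms by simp
  next
    case False
    define \<nu> where "\<nu> = density ?mm (\<lambda>p. dens p / M)"
    have "prob_space \<nu>"
    proof (rule prob_spaceI)
      have "emeasure \<nu> (space \<nu>) = (\<integral>\<^sup>+p. dens p / M \<partial>?mm)"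
        unfolding \<nu>_def by (subst emeasure_density) (auto intro!: nn_integral_cong simp: indicator_def)
      also have "\<dots> = M / M" by (simp add: nn_integral_divide M_def)
      also have "\<dots> = 1" using False Mfin by simp
      finally show "emeasure \<nu> (space \<nu>) = 1" .
    qed
    moreover have "sets \<nu> = sets borel" by (simp add: \<nu>_def sets_pair_m)
    moreover have "(\<Sum>k. \<integral>\<^sup>+u. energy k f u \<partial>m) \<le> ennreal (R\<^sup>2 / (R - 1)) * mm_mean \<phi> m * slope_integral \<phi> \<nu> f"
      if f: "bounded (range f)" "continuous_on UNIV f" for f
    proof -
      let ?g = "\<lambda>p. ennreal (\<phi> (\<bar>f (fst p) - f (snd p)\<bar> / dist (fst p) (snd p)))"
      have [measurable]: "?g \<in> borel_measurable ?mm"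
        using slope_growth_measurable[OF \<phi> f(2)]
        by (simp add: case_prod_beta' measurable_cong_sets[OF sets_pair_m refl])
      have "slope_integral \<phi> \<nu> f = (\<integral>\<^sup>+p. dens p / M * ?g p \<partial>?mm)"
        unfolding slope_integral_def \<nu>_def split_beta by (rule nn_integral_density) measurable
      then have "M * slope_integral \<phi> \<nu> f = (\<integral>\<^sup>+p. M * (dens p / M * ?g p) \<partial>?mm)"
        by (simp add: nn_integral_cmult)
      also have "\<dots> = (\<integral>\<^sup>+p. dens p * ?g p \<partial>?mm)"
        using False Mfin by (intro nn_integral_cong)
          (simp add: mult.assoc[symmetric] ennreal_times_divide mult_divide_eq_ennreal mult.commute[of M])
      also have "\<dots> = (\<Sum>k. \<integral>\<^sup>+u. energy k f u \<partial>m)" by (rule sum_energy_eq[OF f, symmetric])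
      finally have "(\<Sum>k. \<integral>\<^sup>+u. energy k f u \<partial>m) = M * slope_integral \<phi> \<nu> f" by simp
      also have "\<dots> \<le> ennreal (R\<^sup>2 / (R - 1)) * mm_mean \<phi> m * slope_integral \<phi> \<nu> f"
        unfolding M_def by (intro mult_right_mono dens_mass_le) simp
      finally show ?thesis .
    qed
    ultimately show ?thesis using that by blast
  qed
qed

end

lemma mm_sigma_ge_ediam:
  assumes \<phi>: "\<phi> \<in> growth_class a b" and "full_support_prob m"
  shows "ennreal (inv_into {0..} \<phi> 1) * ediam TYPE('a::metric_space) \<le> mm_sigma \<phi> m (x :: 'a)"
proof -
  interpret full_support_prob m by fact
  let ?\<rho> = "inv_into {0..} \<phi> 1"
  let ?h = "\<lambda>\<epsilon>. inv_into {0..} \<phi> (1 / measure m (cball x \<epsilon>))"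
  have "ennreal ?\<rho> * ennreal (dist s t) \<le> mm_sigma \<phi> m x" for s t :: 'a
  proof -
    have "ennreal ?\<rho> * ennreal (dist s t) = (\<integral>\<^sup>+e. ennreal ?\<rho> * indicator {0<..<dist s t} e \<partial>lborel)"
      by (simp add: nn_integral_cmult_indicator)
    also have "\<dots> \<le> mm_sigma \<phi> m x"
      unfolding mm_sigma_def
    proof (rule nn_integral_mono)
      fix e :: real
      show "ennreal ?\<rho> * indicator {0<..<dist s t} e
        \<le> ennreal (?h e) * indicator {\<epsilon>. 0 < \<epsilon> \<and> ennreal \<epsilon> < ediam TYPE('a)} e"
      proof (cases "0 < e \<and> e < dist s t")
        case True
        then have "ennreal e < ennreal (dist s t)" by (simp add: ennreal_less_iff)
        also have "\<dots> \<le> ediam TYPE('a)" unfolding ediam_def by (intro SUP_upper2[of s] SUP_upper) auto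
        finally have "ennreal e < ediam TYPE('a)" .
        moreover have "?\<rho> \<le> ?h e"
        proof (rule growth_inv_le[OF \<phi>])
          show "\<phi> ?\<rho> \<le> 1 / measure m (cball x e)"
            using True measure_cball_pos[of e x] by (simp add: growth_inv[OF \<phi>])
        qed (simp add: growth_inv_nonneg[OF \<phi>])
        ultimately show ?thesis using True by (simp add: ennreal_leI)
      qed auto
    qed
    finally show ?thesis .
  qed
  then show ?thesis
    unfolding ediam_def by (simp add: SUP_mult_left_ennreal SUP_le_iff)
qed

lemma slope_integral_zero_imp_const:
  fixes m :: "'a::metric_space measure"
  assumes \<phi>: "\<phi> \<in> growth_class a b" and "full_support_prob m"
    and f: "continuous_on UNIV f" and 0: "slope_integral \<phi> (m \<Otimes>\<^sub>M m) f = 0"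
  shows "f u = f v"
proof (rule ccontr)
  assume neq: "f u \<noteq> f v"
  interpret full_support_prob m by fact
  interpret mm: pair_prob_space m m by unfold_locales
  let ?W = "{p. f (fst p) \<noteq> f (snd p)}"
  have meas: "(\<lambda>(u, v). ennreal (\<phi> (\<bar>f u - f v\<bar> / dist u v))) \<in> borel_measurable (m \<Otimes>\<^sub>M m)"
    using slope_growth_measurable[OF \<phi> f] by (simp add: measurable_cong_sets[OF sets_pair_m refl])
  have "AE p in m \<Otimes>\<^sub>M m. (\<lambda>(u, v). ennreal (\<phi> (\<bar>f u - f v\<bar> / dist u v))) p = 0"
    using 0 meas unfolding slope_integral_def by (simp add: nn_integral_0_iff_AE)
  then have AE: "AE p in m \<Otimes>\<^sub>M m. p \<notin> ?W"
  proof eventually_elim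
    case (elim p)
    show ?case
    proof
      assume "p \<in> ?W"
      then have "0 < \<bar>f (fst p) - f (snd p)\<bar> / dist (fst p) (snd p)" by (auto simp: zero_less_divide_iff)
      from growth_pos[OF \<phi> this] elim show False by (simp add: split_beta)
    qed
  qed
  have "open ?W"
    by (intro open_Collect_neq continuous_on_compose2[OF f] continuous_intros) auto
  then obtain U V where UV: "open U" "open V" "u \<in> U" "v \<in> V" "U \<times> V \<subseteq> ?W"
    using neq by (auto elim!: open_prod_elim[of _ "(u, v)"])
  have "emeasure (m \<Otimes>\<^sub>M m) ?W = 0"
    using AE \<open>open ?W\<close> by (subst (asm) AE_iff_measurable[of ?W]) (auto simp: sets_pair_m space_pair_measure)
  moreover have "emeasure (m \<Otimes>\<^sub>M m) (U \<times> V) \<le> emeasure (m \<Otimes>\<^sub>M m) ?W"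
    using UV \<open>open ?W\<close> by (intro emeasure_mono) (auto simp: sets_pair_m)
  moreover have "emeasure (m \<Otimes>\<^sub>M m) (U \<times> V) = emeasure m U * emeasure m V"
    using UV by (intro emeasure_pair_measure_Times) (auto simp: sets_m)
  ultimately show False
    using emeasure_open_pos[OF UV(1,3)] emeasure_open_pos[OF UV(2,4)] by auto
qed

lemma (in full_support_prob) deviation_const:
  fixes f :: "'a \<Rightarrow> real"
  assumes "\<And>u v. f u = f v"
  shows "f t - (\<integral>u. f u \<partial>m) = 0"
proof -
  have "f = (\<lambda>_. f t)" using assms by auto
  then have "(\<integral>u. f u \<partial>m) = (\<integral>u. f t \<partial>m)" by metis
  then show ?thesis by (simp add: prob_space[simplified])
qed

lemma exists_deviation_measure:
  fixes m :: "'a::metric_space measure" and A :: ennreal and B :: real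
  assumes m: "full_support_prob m" and a: "0 \<le> a" and b: "0 \<le> b" and \<phi>: "\<phi> \<in> growth_class a b"
    and R: "2 \<le> R"
    and A: "A = (if R = 2 then \<infinity> else ennreal (R ^ 3 / ((R - 1) * (R - 2))))"
    and B: "B = R\<^sup>2 / (R - 1)"
  obtains \<nu> :: "('a \<times> 'a) measure" where "prob_space \<nu>" "sets \<nu> = sets borel"
    "\<And>f t. bounded (range f) \<Longrightarrow> continuous_on UNIV f \<Longrightarrow> ennreal \<bar>f t - (\<integral>u. f u \<partial>m)\<bar>
      \<le> ennreal a * A * mm_sigma \<phi> m t + ennreal (b * B) * mm_mean \<phi> m * slope_integral \<phi> \<nu> f"
proof -
  interpret full_support_prob m by fact
  interpret mm: pair_prob_space m m by unfold_locales
  have b0: "0 < b" and B0: "0 < B" using growth_b_pos[OF \<phi> b] R by (auto simp: B)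
  have \<rho>: "0 < inv_into {0..} \<phi> 1" by (rule growth_inv_1_pos[OF \<phi>])
  note ge = mm_sigma_ge_ediam[OF \<phi> m]
  consider (inf) "mm_mean \<phi> m = \<infinity>" | (deg) "R = 2" "a \<noteq> 0" | (reg) "mm_mean \<phi> m < \<infinity>" "R = 2 \<Longrightarrow> a = 0"
    by (auto simp: less_top[symmetric])
  then show ?thesis
  proof cases
    case inf
    have "ennreal \<bar>f t - (\<integral>u. f u \<partial>m)\<bar> \<le> ennreal a * A * mm_sigma \<phi> m t
        + ennreal (b * B) * mm_mean \<phi> m * slope_integral \<phi> (m \<Otimes>\<^sub>M m) f"
      if f: "continuous_on UNIV f" for f t
    proof (cases "slope_integral \<phi> (m \<Otimes>\<^sub>M m) f = 0")
      case True
      from slope_integral_zero_imp_const[OF \<phi> m f this] have "f t - (\<integral>u. f u \<partial>m) = 0"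
        by (rule deviation_const)
      then show ?thesis by simp
    next
      case False
      then have "ennreal (b * B) * mm_mean \<phi> m * slope_integral \<phi> (m \<Otimes>\<^sub>M m) f = \<top>"
        using inf b0 B0 by (simp add: ennreal_mult_top ennreal_top_mult)
      then show ?thesis by simp
    qed
    then show ?thesis using that[of "m \<Otimes>\<^sub>M m"] mm.prob_space_axioms sets_pair_m by blast
  next
    case deg
    have "ennreal \<bar>f t - (\<integral>u. f u \<partial>m)\<bar> \<le> ennreal a * A * mm_sigma \<phi> m t
        + ennreal (b * B) * mm_mean \<phi> m * slope_integral \<phi> (m \<Otimes>\<^sub>M m) f"
      for f t
    proof (cases "mm_sigma \<phi> m t = 0")
      case True
      then have "ediam TYPE('a) = 0" using ge[of t] \<rho> by auto
      then have "\<And>u v :: 'a. u = v" by (auto simp: ediam_def SUP_eq_iff)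
      then have "f t - (\<integral>u. f u \<partial>m) = 0" by (intro deviation_const) metis
      then show ?thesis by simp
    next
      case False
      then have "ennreal a * A * mm_sigma \<phi> m t = \<top>"
        using deg a A by (simp add: ennreal_mult_top ennreal_top_mult)
      then show ?thesis by simp
    qed
    then show ?thesis using that[of "m \<Otimes>\<^sub>M m"] mm.prob_space_axioms sets_pair_m by blast
  next
    case reg
    obtain x where x: "mm_sigma \<phi> m x < \<infinity>"
    proof (rule ccontr)
      assume "\<not> thesis"
      then have "mm_sigma \<phi> m x = \<infinity>" for x using that by (auto simp: less_top[symmetric])
      then have "mm_mean \<phi> m = \<infinity>" by (simp add: mm_mean_def emeasure_space_1[simplified])
      with reg show False by simp
    qed
    have "ennreal (inv_into {0..} \<phi> 1) * ediam TYPE('a) < \<infinity>" using ge[of x] x by (rule le_less_trans)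
    then have ed: "ediam TYPE('a) < \<infinity>" using \<rho> by (auto simp: ennreal_mult_less_top)
    have dist: "dist u v \<le> enn2real (ediam TYPE('a))" for u v :: 'a
    proof -
      have "ennreal (dist u v) \<le> ediam TYPE('a)" unfolding ediam_def by (intro SUP_upper2[of u] SUP_upper) auto
      from enn2real_mono[OF this] ed show ?thesis by simp
    qed
    interpret majorizing_chain m \<phi> a b R "enn2real (ediam TYPE('a))"
      by unfold_locales (use \<phi> a b R dist in auto)
    obtain \<nu> :: "('a \<times> 'a) measure" where \<nu>: "prob_space \<nu>" "sets \<nu> = sets borel"
      "\<And>f. bounded (range f) \<Longrightarrow> continuous_on UNIV f \<Longrightarrow>
        (\<Sum>k. \<integral>\<^sup>+u. energy k f u \<partial>m) \<le> ennreal (R\<^sup>2 / (R - 1)) * mm_mean \<phi> m * slope_integral \<phi> \<nu> f"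
      using exists_energy_measure[OF reg(1)] by blast
    have aA: "ennreal (a / (R - 2) * R\<^sup>2) \<le> ennreal a * A"
    proof (cases "R = 2")
      case False
      have "a / (R - 2) * R\<^sup>2 \<le> a * (R ^ 3 / ((R - 1) * (R - 2)))"
      proof -
        have "a / (R - 2) * R\<^sup>2 * 1 \<le> a / (R - 2) * R\<^sup>2 * (R / (R - 1))"
          using R a by (intro mult_left_mono) auto
        then show ?thesis by (simp add: power2_eq_square power3_eq_cube mult_ac)
      qed
      then show ?thesis using False R a by (simp add: A ennreal_mult[symmetric] ennreal_leI)
    qed simp
    have "ennreal \<bar>f t - (\<integral>u. f u \<partial>m)\<bar> \<le> ennreal a * A * mm_sigma \<phi> m t
        + ennreal (b * B) * mm_mean \<phi> m * slope_integral \<phi> \<nu> f"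
      if f: "bounded (range f)" "continuous_on UNIV f" for f t
    proof -
      interpret majorizing_chain_fun m \<phi> a b R "enn2real (ediam TYPE('a))" f
        by unfold_locales (use f in auto)
      have "ennreal \<bar>f t - (\<integral>u. f u \<partial>m)\<bar>
        \<le> ennreal (a / (R - 2) * R\<^sup>2) * mm_sigma \<phi> m t + ennreal b * (\<Sum>k. \<integral>\<^sup>+u. energy k f u \<partial>m)"
        by (rule deviation_le_energy[OF reg(2)])
      also have "\<dots> \<le> ennreal a * A * mm_sigma \<phi> m t
          + ennreal b * (ennreal B * mm_mean \<phi> m * slope_integral \<phi> \<nu> f)"
        using \<nu>(3)[OF f] by (intro add_mono mult_right_mono mult_left_mono aA) (auto simp: B)
      finally show ?thesis using b B0 by (simp add: ennreal_mult mult.assoc)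
    qed
    then show ?thesis using that \<nu>(1,2) by blast
  qed
qed

lemma luxemburg_deviation:
  fixes m :: "'a::metric_space measure" and C\<^sub>1 C\<^sub>2 :: ennreal
  assumes "prob_space m" and \<phi>: "\<phi> \<in> growth_class a b" and sets_\<nu>: "sets \<nu> = sets borel"
    and dev: "\<And>f t. bounded (range f) \<Longrightarrow> continuous_on UNIV f \<Longrightarrow> ennreal \<bar>f t - (\<integral>u. f u \<partial>m)\<bar>
      \<le> C\<^sub>1 * mm_sigma \<phi> m t + C\<^sub>2 * mm_mean \<phi> m * slope_integral \<phi> \<nu> f"
    and C\<^sub>2: "C\<^sub>2 \<noteq> 0" and K: "K = (C\<^sub>1 + C\<^sub>2) * mm_sup \<phi> m"
    and \<psi>0: "\<psi> 0 = 0" and \<alpha>: "0 \<le> \<alpha>" and \<beta>: "0 \<le> \<beta>"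
    and \<psi>: "\<And>x y. 0 \<le> x \<Longrightarrow> 0 < y \<Longrightarrow> \<psi> x \<le> \<alpha> + \<beta> * (\<phi> (x * y) / \<phi> y)"
    and f: "bounded (range f)" "continuous_on UNIV f"
  shows "ennreal (\<psi> (enn2real (ennreal \<bar>f t - (\<integral>u. f u \<partial>m)\<bar> / K)))
    \<le> ennreal \<alpha> + ennreal \<beta> * slope_integral \<phi> \<nu> f"
proof -
  interpret prob_space m by fact
  define c where "c = (\<integral>u. f u \<partial>m)"
  define L where "L = enn2real (ennreal \<bar>f t - c\<bar> / K)"
  define S where "S = mm_sup \<phi> m"
  consider "L = 0" | "\<psi> L \<le> \<alpha>" | "0 < L" "\<alpha> < \<psi> L"
    unfolding L_def using enn2real_nonneg by (metis less_eq_real_def not_le)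
  then have "ennreal (\<psi> L) \<le> ennreal \<alpha> + ennreal \<beta> * slope_integral \<phi> \<nu> f"
  proof cases
    case 1 then show ?thesis by (simp add: \<psi>0)
  next
    case 2 then show ?thesis by (intro order_trans[OF ennreal_leI add_increasing2]) auto
  next
    case 3
    have q: "ennreal \<bar>f t - c\<bar> / K \<noteq> 0" "ennreal \<bar>f t - c\<bar> / K \<noteq> \<top>"
      using 3(1) by (auto simp: L_def)
    have K0: "K \<noteq> 0"
      using q by (cases "f t = c") (auto simp: ennreal_divide_zero)
    have Ktop: "K \<noteq> \<top>" using q(1) by auto
    have S: "S \<noteq> 0" "S \<noteq> \<top>" "C\<^sub>1 * S \<noteq> \<top>" "C\<^sub>2 * S \<noteq> \<top>"
      using K0 Ktop C\<^sub>2 unfolding K S_def[symmetric]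
      by (auto simp: distrib_right ennreal_mult_eq_top_iff)
    define g where "g = (\<lambda>x. f x / L)"
    have g: "bounded (range g)" "continuous_on UNIV g"
      using f 3(1) bounded_scaling[OF f(1), of "1 / L"] 
      by (auto simp: g_def image_image intro!: continuous_intros)
    have "K = ennreal (\<bar>f t - c\<bar> / L)"
    proof (cases K)
      case (real k)
      then have k: "0 < k" using K0 by (simp add: less_le)
      then have "L = \<bar>f t - c\<bar> / k" using real by (simp add: L_def divide_ennreal)
      then show ?thesis using k 3(1) real by (auto simp: field_simps)
    qed (use Ktop in simp)
    also have "\<bar>f t - c\<bar> / L = \<bar>g t - (\<integral>u. g u \<partial>m)\<bar>"
      using 3(1) by (simp add: g_def c_def diff_divide_distrib[symmetric])
    also have "ennreal \<dots> \<le> C\<^sub>1 * mm_sigma \<phi> m t + C\<^sub>2 * mm_mean \<phi> m * slope_integral \<phi> \<nu> g"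
      by (rule dev[OF g])
    also have "\<dots> \<le> C\<^sub>1 * S + C\<^sub>2 * S * slope_integral \<phi> \<nu> g"
    proof (intro add_mono mult_left_mono mult_right_mono)
      show "mm_sigma \<phi> m t \<le> S" unfolding S_def mm_sup_def by (rule SUP_upper) simp
      have "mm_mean \<phi> m \<le> (\<integral>\<^sup>+u. S \<partial>m)"
        unfolding mm_mean_def by (intro nn_integral_mono) (auto simp: S_def mm_sup_def intro: SUP_upper)
      then show "mm_mean \<phi> m \<le> S" by (simp add: emeasure_space_1)
    qed auto
    finally have "C\<^sub>1 * S + C\<^sub>2 * S * 1 \<le> C\<^sub>1 * S + C\<^sub>2 * S * slope_integral \<phi> \<nu> g"
      by (simp add: K S_def distrib_right)
    then have "C\<^sub>2 * S * 1 \<le> C\<^sub>2 * S * slope_integral \<phi> \<nu> g"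
      using S by (simp add: ennreal_add_left_cancel_le)
    then have ge1: "1 \<le> slope_integral \<phi> \<nu> g"
      using S C\<^sub>2 by (subst (asm) ennreal_mult_le_mult_iff) auto
    have meas: "(\<lambda>(u, v). ennreal (\<phi> (\<bar>h u - h v\<bar> / dist u v))) \<in> borel_measurable \<nu>"
      if "continuous_on UNIV h" for h :: "'a \<Rightarrow> real"
      using slope_growth_measurable[OF \<phi> that] by (simp add: measurable_cong_sets[OF sets_\<nu> refl])
    have "ennreal (\<psi> L - \<alpha>) \<le> ennreal (\<psi> L - \<alpha>) * slope_integral \<phi> \<nu> g"
      using mult_left_mono[OF ge1, of "ennreal (\<psi> L - \<alpha>)"] by simp
    also have "\<dots> = (\<integral>\<^sup>+p. ennreal (\<psi> L - \<alpha>) * (\<lambda>(u, v). ennreal (\<phi> (\<bar>g u - g v\<bar> / dist u v))) p \<partial>\<nu>)"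
      unfolding slope_integral_def by (rule nn_integral_cmult[symmetric, OF meas[OF g(2)]])
    also have "\<dots> \<le> (\<integral>\<^sup>+p. ennreal \<beta> * (\<lambda>(u, v). ennreal (\<phi> (\<bar>f u - f v\<bar> / dist u v))) p \<partial>\<nu>)"
    proof (rule nn_integral_mono)
      fix p :: "'a \<times> 'a"
      obtain u v where p: "p = (u, v)" by (cases p)
      let ?s = "\<bar>g u - g v\<bar> / dist u v"
      have s: "0 \<le> ?s" by simp
      have Ls: "\<bar>f u - f v\<bar> / dist u v = L * ?s"
        using 3(1) by (simp add: g_def diff_divide_distrib[symmetric])
      have "(\<psi> L - \<alpha>) * \<phi> ?s \<le> \<beta> * \<phi> (L * ?s)"
      proof (cases "?s = 0")
        case True then show ?thesis unfolding True by (simp add: growth_0[OF \<phi>])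
      next
        case False
        then have "0 < ?s" using s by linarith
        from \<psi>[OF less_imp_le[OF 3(1)] this] growth_pos[OF \<phi> this] show ?thesis
          by (simp add: field_simps)
      qed
      then show "ennreal (\<psi> L - \<alpha>) * (case p of (u, v) \<Rightarrow> ennreal (\<phi> (\<bar>g u - g v\<bar> / dist u v)))
        \<le> ennreal \<beta> * (case p of (u, v) \<Rightarrow> ennreal (\<phi> (\<bar>f u - f v\<bar> / dist u v)))"
        using 3(2) \<beta> s growth_nonneg[OF \<phi> s] growth_nonneg[OF \<phi>, of "L * ?s"] 3(1)
        unfolding p Ls prod.case
        by (subst (1 2) ennreal_mult[symmetric]) (auto intro!: ennreal_leI mult_nonneg_nonneg)
    qed
    also have "\<dots> = ennreal \<beta> * slope_integral \<phi> \<nu> f"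
      unfolding slope_integral_def by (rule nn_integral_cmult[OF meas[OF f(2)]])
    finally have "ennreal \<alpha> + ennreal (\<psi> L - \<alpha>) \<le> ennreal \<alpha> + ennreal \<beta> * slope_integral \<phi> \<nu> f"
      by (rule add_left_mono)
    then show ?thesis using 3(2) \<alpha> by (simp add: ennreal_plus[symmetric] del: ennreal_plus)
  qed
  then show ?thesis by (simp add: L_def c_def)
qed

theorem theorem2p1:
  fixes m :: "'a::metric_space measure"
    and a b R B :: real
    and A K :: ennreal
    and \<phi> :: "real \<Rightarrow> real"
  assumes "prob_space m"
    and "sets m = sets borel"
    and "measure_support m = UNIV"
    and "a \<ge> 0" and "b \<ge> 0"
    and "\<phi> \<in> growth_class a b"
    and "R \<ge> 2"
    and "A = (if R = 2 then \<infinity> else ennreal (R ^ 3 / ((R - 1) * (R - 2))))"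
    and "B = R\<^sup>2 / (R - 1)"
    and "K = (ennreal a * A + ennreal (b * B)) * mm_sup \<phi> m"
  shows "\<exists>\<nu> :: ('a \<times> 'a) measure. prob_space \<nu> \<and> sets \<nu> = sets borel \<and>
    (\<forall>f t. bounded (range f) \<and> continuous_on UNIV f \<longrightarrow>
       ennreal \<bar>f t - (\<integral>u. f u \<partial>m)\<bar>
         \<le> ennreal a * A * mm_sigma \<phi> m t + ennreal (b * B) * mm_mean \<phi> m * slope_integral \<phi> \<nu> f) \<and>
    (\<forall>\<psi> \<alpha> \<beta>. mono_on {0..} \<psi> \<and> continuous_on {0..} \<psi> \<and> \<psi> 0 = 0 \<and> \<alpha> \<ge> 0 \<and> \<beta> \<ge> 0 \<and>
       (\<forall>x\<ge>0. \<forall>y>0. \<psi> x \<le> \<alpha> + \<beta> * (\<phi> (x * y) / \<phi> y)) \<longrightarrow>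
       (\<forall>f. bounded (range f) \<and> continuous_on UNIV f \<longrightarrow>
          (SUP t. ennreal (\<psi> (enn2real (ennreal \<bar>f t - (\<integral>u. f u \<partial>m)\<bar> / K))))
            \<le> ennreal \<alpha> + ennreal \<beta> * slope_integral \<phi> \<nu> f))"
proof -
  have m: "full_support_prob m"
    using assms(1-3) by (simp add: full_support_prob_def full_support_prob_axioms_def)
  obtain \<nu> :: "('a \<times> 'a) measure" where \<nu>: "prob_space \<nu>" "sets \<nu> = sets borel"
    and dev: "\<And>f t. bounded (range f) \<Longrightarrow> continuous_on UNIV f \<Longrightarrow> ennreal \<bar>f t - (\<integral>u. f u \<partial>m)\<bar>
      \<le> ennreal a * A * mm_sigma \<phi> m t + ennreal (b * B) * mm_mean \<phi> m * slope_integral \<phi> \<nu> f"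
    using exists_deviation_measure[OF m assms(4-9)] by metis
  have "0 < b * B" using growth_b_pos[OF assms(6,5)] assms(7) by (simp add: assms(9))
  then have bB: "ennreal (b * B) \<noteq> 0" by (simp only: ennreal_eq_0_iff not_le)
  have sup: "(SUP t. ennreal (\<psi> (enn2real (ennreal \<bar>f t - (\<integral>u. f u \<partial>m)\<bar> / K))))
      \<le> ennreal \<alpha> + ennreal \<beta> * slope_integral \<phi> \<nu> f"
    if \<psi>\<alpha>\<beta>: "\<psi> 0 = 0" "\<alpha> \<ge> 0" "\<beta> \<ge> 0" and psi: "\<forall>x\<ge>0. \<forall>y>0. \<psi> x \<le> \<alpha> + \<beta> * (\<phi> (x * y) / \<phi> y)"
      and f: "bounded (range f)" "continuous_on UNIV f" for \<psi> \<alpha> \<beta> f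
  proof (rule SUP_least)
    fix t
    show "ennreal (\<psi> (enn2real (ennreal \<bar>f t - (\<integral>u. f u \<partial>m)\<bar> / K)))
      \<le> ennreal \<alpha> + ennreal \<beta> * slope_integral \<phi> \<nu> f"
    proof (rule luxemburg_deviation[where \<phi> = \<phi> and a = a and b = b and m = m and \<nu> = \<nu>])
      show "\<psi> x \<le> \<alpha> + \<beta> * (\<phi> (x * y) / \<phi> y)" if "0 \<le> x" "0 < y" for x y
        using psi that by blast
    qed (fact assms(1,6,10) \<nu>(2) dev bB \<psi>\<alpha>\<beta> f)+
  qed
  show ?thesis
    using \<nu> dev sup by (intro exI[of _ \<nu>] conjI allI impI) blast+
qed

end
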